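(* Let $\beta>0$ and let $\gamma:[a,b]\to\mathbb{R}^m$ be a continuous ordered $\ell_1$ curve of total $\ell_1$ length $L>0$, with scalar coordinate $\phi:[a,b]\to[0,L]$. For an integer $k\geq 2$, the $k$-point subset of the curve image $\gamma([a,b])$ maximizing the Solow--Polasky diversity $D_\beta$ under the $\ell_1$ norm is obtained by choosing points $y_i=\gamma(t_i)$, $t_i\in[a,b]$, such that $$\phi(t_i)=\frac{(i-1)L}{k-1},\qquad i=1,\ldots,k.$$ Equivalently, the consecutive selected points (listed in their order along the curve) are uniformly spaced in the $\ell_1$ metric: $$\|y_{i+1}-y_i\|_1=\frac{L}{k-1},\qquad i=1,\ldots,k-1.$$ The maximum diversity value is $$1+(k-1)\tanh\!\left(\frac{\beta L}{2(k-1)}\right).$$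
   Context: Solow--Polasky diversity: for $\beta>0$ and a finite subset $S=\{x_1,\ldots,x_k\}$ (with $k$ distinct points) of a metric space $(X,d)$, let $Z_S=\bigl(e^{-\beta d(x_i,x_j)}\bigr)_{i,j=1}^k$; whenever $Z_S$ is nonsingular, $D_\beta(S)=\mathbf{1}^\top Z_S^{-1}\mathbf{1}$, where $\mathbf{1}$ is the all-ones column vector. Here the metric is $d(x,y)=\|x-y\|_1=\sum_{r=1}^m|x_r-y_r|$ on $\mathbb{R}^m$. Ordered $\ell_1$ curve: a continuous curve $\gamma=(\gamma_1,\ldots,\gamma_m):[a,b]\to\mathbb{R}^m$ is called ordered in the $\ell_1$ sense (an ordered $\ell_1$ curve) if each coordinate function $\gamma_r$ is monotone on $[a,b]$. For each coordinate $r$ choose $\sigma_r\in\{-1,+1\}$ such that $\sigma_r\gamma_r$ is nondecreasing. The scalar coordinate of $\gamma$ is $\phi(t)=\sum_{r=1}^m\sigma_r\bigl(\gamma_r(t)-\gamma_r(a)\bigr)$, which is nondecreasing, and the total $\ell_1$ length is $L=\phi(b)=\sum_{r=1}^m|\gamma_r(b)-\gamma_r(a)|$. The map $\phi$ need not be strictly increasing: parameters with equal $\phi$-value correspond to the same point of the curve image, so the points $y_i$ are determined by the values $\phi(t_i)$. *)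

theory Defs
  imports
    "HOL-Analysis.Analysis"
    "Jordan_Normal_Form.Gauss_Jordan_Elimination"
begin

no_notation Matrix.vec_index (infixl "$" 100)

text \<open>
  The points of a finite set are listed in an arbitrary but fixed order. Changing the order
  conjugates the similarity matrix by a permutation matrix, so neither its invertibility nor the
  diversity depends on this choice.
\<close>

definition enumeration :: "'a set \<Rightarrow> 'a list" where
  "enumeration S = (SOME xs. distinct xs \<and> set xs = S)"

definition similarity_mat :: "real \<Rightarrow> ('a \<Rightarrow> 'a \<Rightarrow> real) \<Rightarrow> 'a set \<Rightarrow> real mat" where
  "similarity_mat \<beta> d S =
     Matrix.mat (card S) (card S)
       (\<lambda>(i, j). exp (- \<beta> * d (enumeration S ! i) (enumeration S ! j)))"

text \<open>Only meaningful if \<^term>\<open>similarity_mat \<beta> d S\<close> is invertible.\<close>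

definition solow_polasky :: "real \<Rightarrow> ('a \<Rightarrow> 'a \<Rightarrow> real) \<Rightarrow> 'a set \<Rightarrow> real" where
  "solow_polasky \<beta> d S =
     (let ones = Matrix.vec (card S) (\<lambda>_. 1)
      in scalar_prod ones (mult_mat_vec (the (mat_inverse (similarity_mat \<beta> d S))) ones))"

definition l1_dist :: "real ^ 'm \<Rightarrow> real ^ 'm \<Rightarrow> real" where
  "l1_dist x y = (\<Sum>r\<in>UNIV. \<bar>x $ r - y $ r\<bar>)"

definition ordered_l1_curve :: "real \<Rightarrow> real \<Rightarrow> (real \<Rightarrow> real ^ 'm) \<Rightarrow> bool" where
  "ordered_l1_curve a b \<gamma> \<longleftrightarrow>
     continuous_on {a..b} \<gamma> \<and>
     (\<forall>r. mono_on {a..b} (\<lambda>t. \<gamma> t $ r) \<or> antimono_on {a..b} (\<lambda>t. \<gamma> t $ r))"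

text \<open>Both signs are admissible for a coordinate that is constant on the interval.\<close>

definition orientation :: "real \<Rightarrow> real \<Rightarrow> (real \<Rightarrow> real ^ 'm) \<Rightarrow> ('m \<Rightarrow> real) \<Rightarrow> bool" where
  "orientation a b \<gamma> \<sigma> \<longleftrightarrow>
     (\<forall>r. \<sigma> r \<in> {-1, 1} \<and> mono_on {a..b} (\<lambda>t. \<sigma> r * \<gamma> t $ r))"

definition scalar_coord :: "('m \<Rightarrow> real) \<Rightarrow> real \<Rightarrow> (real \<Rightarrow> real ^ 'm) \<Rightarrow> real \<Rightarrow> real" where
  "scalar_coord \<sigma> a \<gamma> t = (\<Sum>r\<in>UNIV. \<sigma> r * (\<gamma> t $ r - \<gamma> a $ r))"

definition l1_length :: "real \<Rightarrow> real \<Rightarrow> (real \<Rightarrow> real ^ 'm) \<Rightarrow> real" where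
  "l1_length a b \<gamma> = (\<Sum>r\<in>UNIV. \<bar>\<gamma> b $ r - \<gamma> a $ r\<bar>)"

lemma ordered_l1_curve_has_orientation:
  assumes "ordered_l1_curve a b \<gamma>"
  shows "\<exists>\<sigma>. orientation a b \<gamma> \<sigma>"
proof -
  have "\<exists>s. s \<in> {-1, 1::real} \<and> mono_on {a..b} (\<lambda>t. s * \<gamma> t $ r)" for r
  proof (cases "mono_on {a..b} (\<lambda>t. \<gamma> t $ r)")
    case True
    then show ?thesis by (intro exI[of _ 1]) simp
  next
    case False
    then have "antimono_on {a..b} (\<lambda>t. \<gamma> t $ r)"
      using assms by (auto simp: ordered_l1_curve_def)
    then show ?thesis
      by (intro exI[of _ "-1"]) (auto simp: monotone_on_def)
  qed
  then show ?thesis unfolding orientation_def by metis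
qed

lemma scalar_coord_mono_on:
  assumes "orientation a b \<gamma> \<sigma>"
  shows "mono_on {a..b} (scalar_coord \<sigma> a \<gamma>)"
  using assms
  by (auto simp: scalar_coord_def orientation_def monotone_on_def right_diff_distrib
      intro!: sum_mono)

lemma scalar_coord_start: "scalar_coord \<sigma> a \<gamma> a = 0"
  by (simp add: scalar_coord_def)

lemma scalar_coord_end:
  assumes "orientation a b \<gamma> \<sigma>" "a \<le> b"
  shows "scalar_coord \<sigma> a \<gamma> b = l1_length a b \<gamma>"
  unfolding scalar_coord_def l1_length_def
proof (rule sum.cong[OF refl])
  fix r
  have s: "\<sigma> r = -1 \<or> \<sigma> r = 1" and "\<sigma> r * \<gamma> a $ r \<le> \<sigma> r * \<gamma> b $ r"
    using assms by (auto simp: orientation_def monotone_on_def)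
  then show "\<sigma> r * (\<gamma> b $ r - \<gamma> a $ r) = \<bar>\<gamma> b $ r - \<gamma> a $ r\<bar>"
    by auto
qed

end

theory Submission
  imports Defs "Jordan_Normal_Form.Determinant"
begin

text \<open>
  On an ordered curve the \<open>\<ell>\<^sub>1\<close> distance is the difference of scalar coordinates, so everything
  happens for \<open>k\<close> points of the segment \<open>{0..L}\<close>. There the similarity matrix is Markovian: adding
  a point to the right of all others adds a column that, on the old points, is a multiple of the
  column of its neighbour. Solving \<open>Z w = v\<close> point by point therefore shows that \<open>Z\<close> is invertible
  and that a gap \<open>g\<close> between neighbours contributes \<open>tanh (\<beta> g / 2)\<close> to the diversity. By strict
  concavity of \<open>tanh\<close> on the nonnegative reals, in the form of the tangent line at the mean gap, the
  sum of these contributions is largest exactly for equal gaps that exhaust the segment.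
\<close>

section \<open>From similarity matrices to weightings on a finite set\<close>

lemma sum_list_lessThan_bij:
  assumes "distinct xs"
  shows "(\<Sum>j<length xs. g (xs ! j)) = sum g (set xs)"
  using bij_betw_nth[OF assms refl refl] by (simp add: sum.reindex_bij_betw lessThan_atLeast0)

lemma enumeration:
  assumes "finite S"
  shows "distinct (enumeration S)" "set (enumeration S) = S" "length (enumeration S) = card S"
proof -
  have "\<exists>xs. distinct xs \<and> set xs = S"
    using finite_distinct_list[OF assms] by blast
  from someI_ex[OF this] show *: "distinct (enumeration S)" "set (enumeration S) = S"
    unfolding enumeration_def by auto
  then show "length (enumeration S) = card S"
    by (metis distinct_card)
qed

lemma sum_enumeration:
  assumes "finite S"
  shows "(\<Sum>j<card S. g (enumeration S ! j)) = sum g S"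
  using sum_list_lessThan_bij[of "enumeration S" g] enumeration[OF assms] by simp

lemma similarity_mat_carrier: "similarity_mat \<beta> d S \<in> carrier_mat (card S) (card S)"
  by (simp add: similarity_mat_def)

text \<open>Solving for the indicator of each point yields a right inverse column by column, and a
  right inverse of a square matrix is two-sided. Since \<open>sol\<close> speaks of sums over
  \<open>S\<close>, later arguments may list the points in any order.\<close>

lemma invertible_similarity_mat:
  assumes fin: "finite S"
    and sol: "\<And>v :: 'a \<Rightarrow> real. \<exists>w. \<forall>y\<in>S. (\<Sum>z\<in>S. exp (- \<beta> * d y z) * w z) = v y"
  shows "invertible_mat (similarity_mat \<beta> d S)"
proof -
  let ?n = "card S" and ?e = "\<lambda>i. enumeration S ! i"
  let ?Z = "similarity_mat \<beta> d S"
  note e = enumeration[OF fin]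
  obtain W where W: "\<And>x y. y \<in> S \<Longrightarrow>
      (\<Sum>z\<in>S. exp (- \<beta> * d y z) * W x z) = (if y = x then 1 else 0)"
  proof -
    have "\<forall>x. \<exists>w. \<forall>y\<in>S. (\<Sum>z\<in>S. exp (- \<beta> * d y z) * w z) = (if y = x then 1 else 0)"
      by (intro allI sol)
    then show thesis
      using that by (auto dest!: choice)
  qed
  \<comment> \<open>Column \<open>j\<close> solves for the indicator of point \<open>j\<close>,
    which is why the indices are swapped in \<open>W\<close>.\<close>
  define B where "B = Matrix.mat ?n ?n (\<lambda>(i, j). W (?e j) (?e i))"
  have B: "B \<in> carrier_mat ?n ?n"
    by (simp add: B_def)
  have ZB: "?Z * B = 1\<^sub>m ?n"
  proof (rule eq_matI)
    fix i j
    assume "i < dim_row (1\<^sub>m ?n :: real mat)" "j < dim_col (1\<^sub>m ?n :: real mat)"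
    then have ij: "i < ?n" "j < ?n"
      by auto
    then have mem: "?e i \<in> S"
      using e by (metis nth_mem)
    have "(?Z * B) $$ (i, j) = (\<Sum>l<?n. exp (- \<beta> * d (?e i) (?e l)) * W (?e j) (?e l))"
      using ij by (simp add: similarity_mat_def B_def scalar_prod_def lessThan_atLeast0)
    also have "\<dots> = (if ?e i = ?e j then 1 else 0)"
      using W[OF mem] sum_enumeration[OF fin, of "\<lambda>z. exp (- \<beta> * d (?e i) z) * W (?e j) z"]
      by simp
    also have "\<dots> = 1\<^sub>m ?n $$ (i, j)"
      using ij e nth_eq_iff_index_eq[of "enumeration S" i j] by simp
    finally show "(?Z * B) $$ (i, j) = 1\<^sub>m ?n $$ (i, j)" .
  qed (auto simp: similarity_mat_def B_def)
  have "B * ?Z = 1\<^sub>m ?n"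
    using mat_mult_left_right_inverse[OF similarity_mat_carrier B ZB] .
  then show ?thesis
    using ZB B similarity_mat_carrier[of \<beta> d S]
    unfolding invertible_mat_def inverts_mat_def by auto
qed

text \<open>Invertibility forces \<open>w\<close>, listed along \<open>enumeration S\<close>, to be
  the inverse matrix applied to the all-ones vector. Diversity can thus be computed by solving one
  linear system.\<close>

lemma solow_polasky_eq_weighting_sum:
  assumes fin: "finite S" and inv: "invertible_mat (similarity_mat \<beta> d S)"
    and w: "\<And>y. y \<in> S \<Longrightarrow> (\<Sum>z\<in>S. exp (- \<beta> * d y z) * w z) = 1"
  shows "solow_polasky \<beta> d S = sum w S"
proof -
  let ?n = "card S" and ?e = "\<lambda>i. enumeration S ! i"
  let ?Z = "similarity_mat \<beta> d S"
  define ones :: "real Matrix.vec" where "ones = Matrix.vec ?n (\<lambda>_. 1)"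
  define u where "u = Matrix.vec ?n (\<lambda>i. w (?e i))"
  note e = enumeration[OF fin]
  have u: "u \<in> carrier_vec ?n"
    by (simp add: u_def)
  obtain B where B: "?Z * B = 1\<^sub>m ?n" "B * ?Z = 1\<^sub>m (dim_row B)"
    using inv similarity_mat_carrier[of \<beta> d S]
    unfolding invertible_mat_def inverts_mat_def by auto
  \<comment> \<open>The inverse obtained from \<open>invertible_mat\<close> comes without
    dimensions; they are read off from the two products.\<close>
  have Bc: "B \<in> carrier_mat ?n ?n"
    using B similarity_mat_carrier[of \<beta> d S]
    by (metis carrier_matD(2) carrier_matI index_mult_mat(3) index_one_mat(3))
  \<comment> \<open>\<open>solow_polasky\<close> applies \<open>the\<close> to
    \<open>mat_inverse\<close>, whose value is unspecified for \<open>None\<close>; invertibility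
    excludes that case.\<close>
  have "mat_inverse ?Z \<noteq> None"
  proof
    assume "mat_inverse ?Z = None"
    then have "?Z \<notin> Units (ring_mat TYPE(real) ?n ())"
      by (rule mat_inverse(1)[OF similarity_mat_carrier])
    then show False
      using B Bc similarity_mat_carrier[of \<beta> d S]
      unfolding Units_def ring_mat_def by auto
  qed
  then obtain C where C: "mat_inverse ?Z = Some C"
    by auto
  note CZ = mat_inverse(2)[OF similarity_mat_carrier C]
  have "mult_mat_vec ?Z u = ones"
  proof (rule eq_vecI)
    fix i
    assume "i < dim_vec ones"
    then have i: "i < ?n"
      by (simp add: ones_def)
    then have mem: "?e i \<in> S"
      using e by (metis nth_mem)
    have "vec_index (mult_mat_vec ?Z u) i = (\<Sum>l<?n. exp (- \<beta> * d (?e i) (?e l)) * w (?e l))"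
      using i by (simp add: similarity_mat_def u_def scalar_prod_def lessThan_atLeast0)
    also have "\<dots> = 1"
      using w[OF mem] sum_enumeration[OF fin, of "\<lambda>z. exp (- \<beta> * d (?e i) z) * w z"] by simp
    finally show "vec_index (mult_mat_vec ?Z u) i = vec_index ones i"
      using i by (simp add: ones_def)
  qed (simp add: similarity_mat_def ones_def)
  then have "mult_mat_vec C ones = mult_mat_vec (C * ?Z) u"
    using CZ u assoc_mult_mat_vec[of C ?n ?n ?Z ?n u] similarity_mat_carrier by metis
  also have "\<dots> = u"
    using CZ u by simp
  finally have "solow_polasky \<beta> d S = scalar_prod ones u"
    by (simp add: solow_polasky_def Let_def C ones_def)
  also have "\<dots> = (\<Sum>l<?n. w (?e l))"
    by (simp add: scalar_prod_def ones_def u_def lessThan_atLeast0)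
  also have "\<dots> = sum w S"
    by (rule sum_enumeration[OF fin])
  finally show ?thesis .
qed

section \<open>The exponential kernel on the real line\<close>

lemma tanh_half_real: "tanh (x / 2) = (1 - exp (- x)) / (1 + exp (- x :: real))"
  by (simp add: tanh_real_altdef)

text \<open>Induction appends the rightmost point. An arbitrary \<open>v\<close> serves
  invertibility, the constant 1 serves diversity. Both claims concern one \<open>w\<close>, because
  the new total is computed from the old weights; the single point of the base case accounts for the
  leading 1.\<close>

lemma exp_kernel_solution:
  fixes x v :: "nat \<Rightarrow> real"
  assumes "\<beta> > 0" "\<And>i. i < m \<Longrightarrow> x i < x (Suc i)"
  shows "\<exists>w. (\<forall>i\<le>m. (\<Sum>j\<le>m. exp (- \<beta> * \<bar>x i - x j\<bar>) * w j) = v i) \<and>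
    ((\<forall>i\<le>m. v i = 1) \<longrightarrow> sum w {..m} = 1 + (\<Sum>i<m. tanh (\<beta> * (x (Suc i) - x i) / 2)))"
  using assms(2)
proof (induction m)
  case 0
  show ?case
    by (rule exI[of _ v]) simp
next
  case (Suc m)
  have less: "x i < x (Suc i)" if "i \<le> m" for i
    using Suc.prems that by simp
  obtain w where w: "\<And>i. i \<le> m \<Longrightarrow> (\<Sum>j\<le>m. exp (- \<beta> * \<bar>x i - x j\<bar>) * w j) = v i"
    and sum_w: "(\<forall>i\<le>m. v i = 1) \<Longrightarrow>
      sum w {..m} = 1 + (\<Sum>i<m. tanh (\<beta> * (x (Suc i) - x i) / 2))"
  proof -
    have "\<exists>w. (\<forall>i\<le>m. (\<Sum>j\<le>m. exp (- \<beta> * \<bar>x i - x j\<bar>) * w j) = v i) \<and>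
        ((\<forall>i\<le>m. v i = 1) \<longrightarrow> sum w {..m} = 1 + (\<Sum>i<m. tanh (\<beta> * (x (Suc i) - x i) / 2)))"
      by (rule Suc.IH) (rule less, simp)
    then show thesis
      using that by blast
  qed
  have le: "x i \<le> x m" if "i \<le> m" for i
    using that
  proof (induction rule: inc_induct)
    case (step n)
    then show ?case using less[of n] by simp
  qed simp
  define q where "q = exp (- \<beta> * (x (Suc m) - x m))"
  have q: "0 < q" "q < 1"
    using less[of m] assms(1) by (auto simp: q_def mult_neg_pos)
  \<comment> \<open>The distance from an old point to the new one runs through the neighbour
    \<open>x m\<close>, so the exponential factors.\<close>
  have kernel_last: "exp (- \<beta> * \<bar>x i - x (Suc m)\<bar>) = q * exp (- \<beta> * \<bar>x i - x m\<bar>)"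
    if "i \<le> m" for i
    using le[OF that] less[of m] unfolding q_def exp_add[symmetric] by (simp add: algebra_simps)
  \<comment> \<open>With the old weights the last row evaluates to \<open>q * v m\<close>, and the
    correction will add \<open>c - q * q * c\<close>. This \<open>c\<close> makes up the difference
    to \<open>v (Suc m)\<close>.\<close>
  define c where "c = (v (Suc m) - q * v m) / (1 - q\<^sup>2)"
  have "q\<^sup>2 < 1"
    using q by (simp add: power_less_one_iff abs_square_less_1)
  then have c: "c * (1 - q\<^sup>2) = v (Suc m) - q * v m"
    by (simp add: c_def)
  \<comment> \<open>On the old points the column of the new point is \<open>q\<close> times that of the previous one, so
    adding \<open>c\<close> at the former and \<open>- q * c\<close> at the latter only affects the last equation.\<close>
  define w' where "w' j = (if j = Suc m then c else if j = m then w m - q * c else w j)" for j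
  have w'_last: "w' (Suc m) = c"
    by (simp add: w'_def)
  \<comment> \<open>The row \<open>g\<close> is arbitrary: kernel rows give the equations, the
    constant row 1 gives the total weight.\<close>
  have upd: "(\<Sum>j\<le>m. g j * w' j) = (\<Sum>j\<le>m. g j * w j) - g m * q * c" for g :: "nat \<Rightarrow> real"
  proof -
    have "(\<Sum>j\<le>m. g j * w' j) = (\<Sum>j\<le>m. g j * w j - (if j = m then g m * q * c else 0))"
      by (rule sum.cong) (auto simp: w'_def algebra_simps)
    then show ?thesis
      by (simp add: sum_subtractf)
  qed
  have "(\<Sum>j\<le>Suc m. exp (- \<beta> * \<bar>x i - x j\<bar>) * w' j) = v i" if "i \<le> Suc m" for i
  proof (cases "i = Suc m")
    case False
    then have i: "i \<le> m"
      using that by simp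
    show ?thesis
      using w[OF i] kernel_last[OF i] by (simp add: upd w'_last)
  next
    case True
    have "(\<Sum>j\<le>m. exp (- \<beta> * \<bar>x (Suc m) - x j\<bar>) * w j)
        = q * (\<Sum>j\<le>m. exp (- \<beta> * \<bar>x m - x j\<bar>) * w j)"
      unfolding sum_distrib_left
      by (rule sum.cong) (use kernel_last le less[of m] in \<open>auto simp: abs_minus_commute\<close>)
    also have "\<dots> = q * v m"
      using w[of m] by simp
    finally have "(\<Sum>j\<le>Suc m. exp (- \<beta> * \<bar>x i - x j\<bar>) * w' j) = q * v m - q * q * c + c"
      using kernel_last[of m] True by (simp add: upd w'_last abs_minus_commute)
    also have "\<dots> = q * v m + c * (1 - q\<^sup>2)"
      by (simp add: algebra_simps power2_eq_square)
    finally show ?thesis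
      using True c by simp
  qed
  moreover have "sum w' {..Suc m} = 1 + (\<Sum>i<Suc m. tanh (\<beta> * (x (Suc i) - x i) / 2))"
    if "\<forall>i\<le>Suc m. v i = 1"
  proof -
    \<comment> \<open>For right-hand side 1 the total grows by
      \<open>c - q * c = (1 - q) / (1 + q)\<close>, which is tanh of half the scaled gap.\<close>
    have "c = (1 - q) / (1 - q\<^sup>2)"
      using that by (simp add: c_def)
    also have "\<dots> = 1 / (1 + q)"
      using q \<open>q\<^sup>2 < 1\<close> by (simp add: field_simps power2_eq_square)
    finally have "c * (1 - q) = tanh (\<beta> * (x (Suc m) - x m) / 2)"
      unfolding tanh_half_real by (simp add: q_def)
    moreover have "sum w' {..Suc m} = sum w {..m} + c * (1 - q)"
      using upd[of "\<lambda>_. 1"] by (simp add: w'_last algebra_simps)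
    ultimately show ?thesis
      using sum_w that by simp
  qed
  ultimately show ?case
    by (intro exI[of _ w']) blast
qed

text \<open>\<open>p\<close> embeds the points isometrically in the line and \<open>f\<close> lists
  them from left to right, so the weights found for the indices carry over to
  \<open>S\<close>.\<close>

lemma solow_polasky_on_line:
  fixes p :: "'a \<Rightarrow> real"
  assumes "\<beta> > 0" and f: "bij_betw f {..m} S"
    and less: "\<And>i. i < m \<Longrightarrow> p (f i) < p (f (Suc i))"
    and d: "\<And>y z. y \<in> S \<Longrightarrow> z \<in> S \<Longrightarrow> d y z = \<bar>p y - p z\<bar>"
  shows "invertible_mat (similarity_mat \<beta> d S)"
    and "solow_polasky \<beta> d S = 1 + (\<Sum>i<m. tanh (\<beta> * (p (f (Suc i)) - p (f i)) / 2))"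
proof -
  have fin: "finite S"
    using f bij_betw_finite by blast
  have sol: "\<exists>w. (\<forall>y\<in>S. (\<Sum>z\<in>S. exp (- \<beta> * d y z) * w z) = v y) \<and>
      ((\<forall>y\<in>S. v y = 1) \<longrightarrow>
        sum w S = 1 + (\<Sum>i<m. tanh (\<beta> * (p (f (Suc i)) - p (f i)) / 2)))" for v :: "'a \<Rightarrow> real"
  proof -
    obtain w where w: "\<forall>i\<le>m. (\<Sum>j\<le>m. exp (- \<beta> * \<bar>p (f i) - p (f j)\<bar>) * w j) = v (f i)"
      and sum_w: "(\<forall>i\<le>m. v (f i) = 1) \<longrightarrow>
        sum w {..m} = 1 + (\<Sum>i<m. tanh (\<beta> * (p (f (Suc i)) - p (f i)) / 2))"
      using exp_kernel_solution[OF \<open>\<beta> > 0\<close>, of m "\<lambda>i. p (f i)" "\<lambda>i. v (f i)"] less by blast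
    define u where "u y = w (inv_into {..m} f y)" for y
    have u: "u (f j) = w j" if "j \<le> m" for j
      using f that by (simp add: u_def bij_betw_def)
    have mem: "f j \<in> S" if "j \<le> m" for j
      using f that by (auto simp: bij_betw_def)
    have sum_S: "sum g S = (\<Sum>j\<le>m. g (f j))" for g :: "'a \<Rightarrow> real"
      by (rule sum.reindex_bij_betw[OF f, symmetric])
    have "(\<Sum>z\<in>S. exp (- \<beta> * d y z) * u z) = v y" if y: "y \<in> S" for y
    proof -
      have "y \<in> f ` {..m}"
        using y bij_betw_imp_surj_on[OF f] by simp
      then obtain i where i: "i \<le> m" "y = f i"
        by auto
      have "(\<Sum>z\<in>S. exp (- \<beta> * d y z) * u z) =
          (\<Sum>j\<le>m. exp (- \<beta> * \<bar>p (f i) - p (f j)\<bar>) * w j)"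
        unfolding sum_S using i by (intro sum.cong) (auto simp: d mem u)
      then show ?thesis
        using w i by simp
    qed
    moreover have "sum u S = sum w {..m}"
      unfolding sum_S by (rule sum.cong) (auto simp: u)
    ultimately show ?thesis
      using sum_w mem by (intro exI[of _ u]) auto
  qed
  show inv: "invertible_mat (similarity_mat \<beta> d S)"
    using sol by (intro invertible_similarity_mat fin) blast
  show "solow_polasky \<beta> d S = 1 + (\<Sum>i<m. tanh (\<beta> * (p (f (Suc i)) - p (f i)) / 2))"
  proof -
    obtain w where "\<And>y. y \<in> S \<Longrightarrow> (\<Sum>z\<in>S. exp (- \<beta> * d y z) * w z) = 1"
      and "sum w S = 1 + (\<Sum>i<m. tanh (\<beta> * (p (f (Suc i)) - p (f i)) / 2))"
      using sol[of "\<lambda>_. 1"] by blast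
    then show ?thesis
      using solow_polasky_eq_weighting_sum[OF fin inv, of w] by simp
  qed
qed

lemma increasing_enumeration:
  fixes p :: "'a \<Rightarrow> 'b :: linorder"
  assumes "inj_on p S" "card S = Suc m"
  obtains f where "bij_betw f {..m} S" "\<And>i. i < m \<Longrightarrow> p (f i) < p (f (Suc i))"
proof -
  define xs where "xs = sorted_list_of_set (p ` S)"
  have fin: "finite S"
    using assms(2) by (simp add: card_ge_0_finite)
  have len: "length xs = Suc m"
    using assms by (simp add: xs_def card_image)
  have xs: "set xs = p ` S" "distinct xs" "sorted_wrt (<) xs"
    using fin by (auto simp: xs_def)
  have "bij_betw ((!) xs) {..<length xs} (p ` S)"
    using xs by (intro bij_betw_nth) auto
  then have 1: "bij_betw ((!) xs) {..m} (p ` S)"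
    by (simp add: len lessThan_Suc_atMost)
  have 2: "bij_betw (inv_into S p) (p ` S) S"
    using assms(1) by (simp add: bij_betw_inv_into bij_betw_def inj_on_inv_into inv_into_image_cancel)
  define f where "f = inv_into S p \<circ> (!) xs"
  have f: "p (f i) = xs ! i" if "i \<le> m" for i
    using bij_betw_apply[OF 1, of i] that by (simp add: f_def f_inv_into_f)
  show thesis
  proof
    show "bij_betw f {..m} S"
      unfolding f_def by (rule bij_betw_trans[OF 1 2])
    show "p (f i) < p (f (Suc i))" if "i < m" for i
      using that f sorted_wrt_nth_less[OF xs(3), of i "Suc i"] len by simp
  qed
qed

section \<open>Strict concavity of tanh and sums of tanh\<close>

text \<open>By the mean value theorem the secant slope is \<open>1 - (tanh z)^2\<close> for some
  \<open>z\<close> between \<open>u\<close> and \<open>c\<close>. On the nonnegative reals this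
  slope strictly decreases, so it exceeds the slope at \<open>c\<close> on the left of
  \<open>c\<close> and stays below it on the right.\<close>

lemma tanh_less_tangent:
  fixes c u :: real
  assumes "0 \<le> u" "0 \<le> c" "u \<noteq> c"
  shows "tanh u < tanh c + (1 - (tanh c)\<^sup>2) * (u - c)"
proof -
  have deriv: "(tanh has_real_derivative 1 - (tanh z)\<^sup>2) (at z)" for z :: real
    by (auto intro!: derivative_eq_intros)
  show ?thesis
  proof (cases "u < c")
    case True
    obtain z where z: "u < z" "z < c" "tanh c - tanh u = (c - u) * (1 - (tanh z)\<^sup>2)"
      using MVT2[OF True, of tanh "\<lambda>z. 1 - (tanh z)\<^sup>2"] deriv by blast
    have "(tanh z)\<^sup>2 < (tanh c)\<^sup>2"
      using z assms by (intro power_strict_mono) auto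
    then have "(c - u) * (1 - (tanh c)\<^sup>2) < (c - u) * (1 - (tanh z)\<^sup>2)"
      using True by (intro mult_strict_left_mono) auto
    with z show ?thesis
      by (simp add: algebra_simps)
  next
    case False
    then have cu: "c < u"
      using assms by simp
    obtain z where z: "c < z" "z < u" "tanh u - tanh c = (u - c) * (1 - (tanh z)\<^sup>2)"
      using MVT2[OF cu, of tanh "\<lambda>z. 1 - (tanh z)\<^sup>2"] deriv by blast
    have "(tanh c)\<^sup>2 < (tanh z)\<^sup>2"
      using z assms by (intro power_strict_mono) auto
    then have "(u - c) * (1 - (tanh z)\<^sup>2) < (u - c) * (1 - (tanh c)\<^sup>2)"
      using cu by (intro mult_strict_left_mono) auto
    with z show ?thesis
      by (simp add: algebra_simps)
  qed
qed

text \<open>Adding the tangent inequalities at \<open>c\<close> leaves a nonnegative slope times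
  \<open>sum u I - card I * c\<close>, which is at most 0. One estimate thus covers both unequal
  terms and a total that falls short; strictness away from \<open>c\<close> settles
  equality.\<close>

lemma sum_tanh_le:
  fixes u :: "'i \<Rightarrow> real" and c :: real
  assumes fin: "finite I" and u: "\<And>i. i \<in> I \<Longrightarrow> 0 \<le> u i" and c: "0 \<le> c"
    and sum: "sum u I \<le> card I * c"
  shows "(\<Sum>i\<in>I. tanh (u i)) \<le> card I * tanh c"
    and "(\<Sum>i\<in>I. tanh (u i)) = card I * tanh c \<Longrightarrow> i \<in> I \<Longrightarrow> u i = c"
proof -
  define T where "T i = tanh c + (1 - (tanh c)\<^sup>2) * (u i - c)" for i
  have le: "tanh (u i) \<le> T i" if "i \<in> I" for i
    using tanh_less_tangent[OF u[OF that] c] by (cases "u i = c") (auto simp: T_def)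
  have "sum T I = card I * tanh c + (1 - (tanh c)\<^sup>2) * (sum u I - card I * c)"
    by (simp add: T_def sum.distrib sum_subtractf flip: sum_distrib_left)
  moreover have "(tanh c)\<^sup>2 \<le> 1"
    using tanh_real_bounds[of c] by (simp add: abs_square_le_1 abs_le_iff)
  ultimately have T: "sum T I \<le> card I * tanh c"
    using sum by (simp add: mult_nonneg_nonpos)
  show "(\<Sum>i\<in>I. tanh (u i)) \<le> card I * tanh c"
    using sum_mono[of I "\<lambda>i. tanh (u i)" T] le T by force
  show "u i = c" if "(\<Sum>i\<in>I. tanh (u i)) = card I * tanh c" "i \<in> I"
  proof (rule ccontr)
    assume "u i \<noteq> c"
    then have "tanh (u i) < T i"
      using tanh_less_tangent[OF u c] that by (simp add: T_def)
    then have "(\<Sum>i\<in>I. tanh (u i)) < sum T I"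
      using fin le that by (intro sum_strict_mono_ex1) auto
    then show False
      using T that by simp
  qed
qed

section \<open>Optimal point sets in a segment\<close>

lemma solow_polasky_segment:
  fixes p :: "'a \<Rightarrow> real" and \<beta> L :: real
  defines "M \<equiv> \<lambda>n. 1 + real n * tanh (\<beta> * L / (2 * real n))"
  assumes "\<beta> > 0" "L > 0" "n > 0" and inj: "inj_on p S" and card: "card S = Suc n"
    and sub: "p ` S \<subseteq> {0..L}"
    and d: "\<And>y z. y \<in> S \<Longrightarrow> z \<in> S \<Longrightarrow> d y z = \<bar>p y - p z\<bar>"
  shows "invertible_mat (similarity_mat \<beta> d S)"
    and "solow_polasky \<beta> d S \<le> M n"
    and "solow_polasky \<beta> d S = M n \<longleftrightarrow> p ` S = (\<lambda>i. real i * L / n) ` {..n}"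
proof -
  obtain f where f: "bij_betw f {..n} S" and less: "\<And>i. i < n \<Longrightarrow> p (f i) < p (f (Suc i))"
    using increasing_enumeration[OF inj card] by blast
  \<comment> \<open>The listing stays open: the sorted \<open>f\<close> serves the bound, an
    explicit \<open>g\<close> the converse of the equality case.\<close>
  note line = solow_polasky_on_line[where p = p, OF \<open>\<beta> > 0\<close> _ _ d]
  show "invertible_mat (similarity_mat \<beta> d S)"
    by (rule line(1)[OF f less])
  have D: "solow_polasky \<beta> d S = 1 + (\<Sum>i<n. tanh (\<beta> * (p (f (Suc i)) - p (f i)) / 2))"
    by (rule line(2)[OF f less])
  \<comment> \<open>If the points exhaust the segment, the mean gap is \<open>L / n\<close>;
    \<open>c\<close> is this mean times \<open>\<beta> / 2\<close>, the same scaling as in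
    \<open>u\<close>.\<close>
  define c where "c = \<beta> * L / (2 * real n)"
  define u where "u i = \<beta> * (p (f (Suc i)) - p (f i)) / 2" for i
  have D_u: "solow_polasky \<beta> d S = 1 + (\<Sum>i<n. tanh (u i))"
    using D by (simp add: u_def)
  have range_p: "0 \<le> p (f i)" "p (f i) \<le> L" if "i \<le> n" for i
    using sub bij_betw_apply[OF f, of i] that by auto
  have "sum u {..<n} = \<beta> / 2 * (\<Sum>i<n. p (f (Suc i)) - p (f i))"
    by (simp add: u_def sum_distrib_left)
  also have "\<dots> = \<beta> / 2 * (p (f n) - p (f 0))"
    using sum_lessThan_telescope[of "\<lambda>i. p (f i)" n] by simp
  \<comment> \<open>After telescoping only the distance between the extreme points remains, and both
    lie in the segment.\<close>
  also have "\<dots> \<le> \<beta> / 2 * L"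
    using range_p[of n] range_p[of 0] \<open>\<beta> > 0\<close> by (intro mult_left_mono) auto
  also have "\<dots> = card {..<n} * c"
    using \<open>n > 0\<close> by (simp add: c_def)
  finally have sum_u: "sum u {..<n} \<le> card {..<n} * c" .
  have u0: "0 \<le> u i" if "i \<in> {..<n}" for i
    using less[of i] that \<open>\<beta> > 0\<close> by (simp add: u_def)
  have c0: "0 \<le> c"
    using \<open>\<beta> > 0\<close> \<open>L > 0\<close> by (simp add: c_def)
  note tanh = sum_tanh_le[OF finite_lessThan u0 c0 sum_u]
  have M: "M n = 1 + n * tanh c"
    by (simp add: M_def c_def)
  show "solow_polasky \<beta> d S \<le> M n"
    using tanh(1) by (simp add: D_u M)
  show "solow_polasky \<beta> d S = M n \<longleftrightarrow> p ` S = (\<lambda>i. real i * L / n) ` {..n}"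
  proof
    assume "solow_polasky \<beta> d S = M n"
    then have "u i = c" if "i < n" for i
      using tanh(2)[of i] that by (simp add: D_u M)
    then have "\<beta> * (p (f (Suc i)) - p (f i)) = \<beta> * (L / n)" if "i < n" for i
      using that by (simp add: u_def c_def)
    then have gap: "p (f (Suc i)) = p (f i) + L / n" if "i < n" for i
      using that \<open>\<beta> > 0\<close> mult_left_cancel[of \<beta>] by (metis less_irrefl diff_eq_eq add.commute)
    have shift: "p (f i) = p (f 0) + real i * L / n" if "i \<le> n" for i
      using that
    proof (induction i)
      case (Suc i)
      then show ?case
        using gap[of i] by (simp add: add_divide_distrib distrib_right)
    qed simp
    \<comment> \<open>The equal gaps already span the length \<open>L\<close>, so the first point
      has no room to leave 0.\<close>
    have "p (f 0) = 0"
      using shift[of n] range_p[of 0] range_p[of n] \<open>n > 0\<close> by simp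
    then have "p (f i) = real i * L / n" if "i \<le> n" for i
      using shift[OF that] by simp
    then have "p ` f ` {..n} = (\<lambda>i. real i * L / n) ` {..n}"
      unfolding image_image by (intro image_cong) auto
    then show "p ` S = (\<lambda>i. real i * L / n) ` {..n}"
      using bij_betw_imp_surj_on[OF f] by simp
  next
    assume Q: "p ` S = (\<lambda>i. real i * L / n) ` {..n}"
    \<comment> \<open>Instead of identifying the sorted listing \<open>f\<close>, the points are
      listed anew by their known positions.\<close>
    define g where "g = inv_into S p \<circ> (\<lambda>i. real i * L / n)"
    have "bij_betw (\<lambda>i. real i * L / n) {..n} (p ` S)"
      using Q \<open>n > 0\<close> \<open>L > 0\<close> by (auto simp: bij_betw_def inj_on_def)
    moreover have "bij_betw (inv_into S p) (p ` S) S"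
      using bij_betw_inv_into inj by (metis bij_betw_def)
    ultimately have g: "bij_betw g {..n} S"
      unfolding g_def by (rule bij_betw_trans)
    have p_g: "p (g i) = real i * L / n" if "i \<le> n" for i
    proof -
      have "real i * L / n \<in> p ` S"
        unfolding Q using that by (intro imageI) simp
      then show ?thesis
        by (simp add: g_def f_inv_into_f)
    qed
    have "p (g (Suc i)) - p (g i) = L / n" if "i < n" for i
      using that by (simp add: p_g diff_divide_distrib[symmetric] left_diff_distrib[symmetric])
    moreover from this have "p (g i) < p (g (Suc i))" if "i < n" for i
      using that \<open>L > 0\<close> by (simp add: p_g divide_strict_right_mono)
    ultimately have "solow_polasky \<beta> d S = 1 + (\<Sum>i<n. tanh (\<beta> * (L / n) / 2))"
      using line(2)[OF g] by simp
    then show "solow_polasky \<beta> d S = M n"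
      by (simp add: M_def mult.commute)
  qed
qed

section \<open>The scalar coordinate as an isometry onto a segment\<close>

lemma l1_dist_eq_0D: "l1_dist x y = 0 \<Longrightarrow> x = y"
  by (simp add: l1_dist_def sum_nonneg_eq_0_iff Finite_Cartesian_Product.vec_eq_iff)

lemma l1_dist_commute: "l1_dist x y = l1_dist y x"
  by (simp add: l1_dist_def abs_minus_commute)

text \<open>After multiplication by \<open>\<sigma> r\<close> no coordinate decreases, so for
  \<open>s \<le> t\<close> the absolute values drop out and the summands add up to the increment of
  the scalar coordinate. Symmetry gives the other order.\<close>

lemma l1_dist_on_curve:
  assumes or: "orientation a b \<gamma> \<sigma>" and "s \<in> {a..b}" "t \<in> {a..b}"
  shows "l1_dist (\<gamma> s) (\<gamma> t) = \<bar>scalar_coord \<sigma> a \<gamma> s - scalar_coord \<sigma> a \<gamma> t\<bar>"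
proof -
  have *: "l1_dist (\<gamma> s) (\<gamma> t) = scalar_coord \<sigma> a \<gamma> t - scalar_coord \<sigma> a \<gamma> s"
    if "s \<in> {a..b}" "t \<in> {a..b}" "s \<le> t" for s t
  proof -
    have "\<bar>\<gamma> s $ r - \<gamma> t $ r\<bar> = \<sigma> r * (\<gamma> t $ r - \<gamma> a $ r) - \<sigma> r * (\<gamma> s $ r - \<gamma> a $ r)" for r
    proof -
      have "\<sigma> r = -1 \<or> \<sigma> r = 1" "\<sigma> r * \<gamma> s $ r \<le> \<sigma> r * \<gamma> t $ r"
        using or that by (auto simp: orientation_def monotone_on_def)
      then show ?thesis
        by auto
    qed
    then show ?thesis
      by (simp add: l1_dist_def scalar_coord_def sum_subtractf)
  qed
  have mono: "mono_on {a..b} (scalar_coord \<sigma> a \<gamma>)"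
    by (rule scalar_coord_mono_on[OF or])
  show ?thesis
    using *[of s t] *[of t s] assms monotone_onD[OF mono, of s t] monotone_onD[OF mono, of t s]
    by (cases "s \<le> t") (auto simp: l1_dist_commute)
qed

text \<open>Monotonicity and the end values give one inclusion, the intermediate value theorem the
  other. Every equally spaced position is therefore attained on the curve.\<close>

lemma scalar_coord_image:
  assumes "orientation a b \<gamma> \<sigma>" "continuous_on {a..b} \<gamma>" "a \<le> b"
  shows "scalar_coord \<sigma> a \<gamma> ` {a..b} = {0..l1_length a b \<gamma>}"
proof
  note mono = scalar_coord_mono_on[OF assms(1)]
  show "scalar_coord \<sigma> a \<gamma> ` {a..b} \<subseteq> {0..l1_length a b \<gamma>}"
    using monotone_onD[OF mono, of a] monotone_onD[OF mono, of _ b] assms(3)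
    by (auto simp: scalar_coord_start simp flip: scalar_coord_end[OF assms(1,3)])
  have "continuous_on {a..b} (scalar_coord \<sigma> a \<gamma>)"
    unfolding scalar_coord_def[abs_def] using assms(2) by (intro continuous_intros)
  then show "{0..l1_length a b \<gamma>} \<subseteq> scalar_coord \<sigma> a \<gamma> ` {a..b}"
    using IVT'[of "scalar_coord \<sigma> a \<gamma>" a _ b] assms(3)
    by (force simp: scalar_coord_start scalar_coord_end[OF assms(1,3)])
qed

section \<open>Maximizers on the ordered curve\<close>

theorem theorem2:
  fixes \<gamma> :: "real \<Rightarrow> real ^ 'm" and \<sigma> :: "'m \<Rightarrow> real" and \<beta> a b :: real and k :: nat
  defines "\<phi> \<equiv> scalar_coord \<sigma> a \<gamma>"
    and "L \<equiv> l1_length a b \<gamma>"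
    and "D \<equiv> solow_polasky \<beta> l1_dist"
    and "admissible \<equiv> (\<lambda>S. S \<subseteq> \<gamma> ` {a..b} \<and> card S = k)"
  assumes "0 < \<beta>" and "a \<le> b"
    and "ordered_l1_curve a b \<gamma>"
    and "orientation a b \<gamma> \<sigma>"
    and "0 < L"
    and "2 \<le> k"
  shows
    "(\<forall>S. admissible S \<longrightarrow> invertible_mat (similarity_mat \<beta> l1_dist S)) \<and>
     (\<exists>!S. is_arg_max D admissible S) \<and>
     (\<forall>S. is_arg_max D admissible S \<longleftrightarrow>
        (\<exists>t. t ` {1..k} \<subseteq> {a..b} \<and> S = (\<lambda>i. \<gamma> (t i)) ` {1..k} \<and>
           (\<forall>i\<in>{1..k}. \<phi> (t i) = (real i - 1) * L / (real k - 1)))) \<and>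
     (\<forall>S. is_arg_max D admissible S \<longleftrightarrow>
        (\<exists>t. t ` {1..k} \<subseteq> {a..b} \<and> mono_on {1..k} t \<and> S = (\<lambda>i. \<gamma> (t i)) ` {1..k} \<and>
           (\<forall>i\<in>{1..<k}. l1_dist (\<gamma> (t (i + 1))) (\<gamma> (t i)) = L / (real k - 1)))) \<and>
     (\<forall>t. t ` {1..k} \<subseteq> {a..b} \<and> mono_on {1..k} t \<longrightarrow>
        ((\<forall>i\<in>{1..k}. \<phi> (t i) = (real i - 1) * L / (real k - 1)) \<longleftrightarrow>
         (\<forall>i\<in>{1..<k}. l1_dist (\<gamma> (t (i + 1))) (\<gamma> (t i)) = L / (real k - 1)))) \<and>
     (\<forall>S. is_arg_max D admissible S \<longrightarrow>
        D S = 1 + (real k - 1) * tanh (\<beta> * L / (2 * (real k - 1))))"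
proof -
  let ?G = "\<gamma> ` {a..b}"
  note or = \<open>orientation a b \<gamma> \<sigma>\<close>
  obtain n where k: "k = Suc n" and n: "n > 0"
    using \<open>2 \<le> k\<close> by (cases k) auto
  define q where "q i = (real i - 1) * L / (real k - 1)" for i
  define M where "M = 1 + real n * tanh (\<beta> * L / (2 * real n))"
  \<comment> \<open>Several parameters may give the same point, while diversity concerns points. The
    coordinate is therefore defined on the ambient space and agrees with \<open>\<phi>\<close> along
    the curve.\<close>
  define p where "p y = (\<Sum>r\<in>UNIV. \<sigma> r * (y $ r - \<gamma> a $ r))" for y
  have p_\<gamma>: "p (\<gamma> t) = \<phi> t" for t
    by (simp add: p_def \<phi>_def scalar_coord_def)
  have dist: "l1_dist y z = \<bar>p y - p z\<bar>" if "y \<in> ?G" "z \<in> ?G" for y z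
    using that l1_dist_on_curve[OF or] by (auto simp: p_\<gamma> \<phi>_def)
  have inj: "inj_on p ?G"
  proof (rule inj_onI)
    fix y z
    assume "y \<in> ?G" "z \<in> ?G" "p y = p z"
    then have "l1_dist y z = 0"
      by (simp only: dist)
    then show "y = z"
      by (rule l1_dist_eq_0D)
  qed
  have \<phi>_image: "\<phi> ` {a..b} = {0..L}"
    using scalar_coord_image[OF or] assms(7) \<open>a \<le> b\<close>
    by (simp add: \<phi>_def L_def ordered_l1_curve_def)
  then have p_image: "p ` ?G = {0..L}"
    by (simp add: image_image p_\<gamma>)
  \<comment> \<open>Passes from numbering the points from 1 to numbering them from 0, as on the
    segment.\<close>
  have q_image: "q ` {1..k} = (\<lambda>i. real i * L / n) ` {..n}"
    unfolding k image_Suc_atMost[symmetric] image_image by (simp add: q_def k)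
  have q_range: "q ` {1..k} \<subseteq> {0..L}"
    unfolding q_image using \<open>0 < L\<close> n by (auto simp: field_simps)
  have q_step: "q (i + 1) = q i + L / (real k - 1)" for i
    by (simp add: q_def left_diff_distrib diff_divide_distrib)
  have inj_q: "inj_on q {1..k}"
    using \<open>0 < L\<close> n by (auto simp: inj_on_def q_def k)
  have seg: "invertible_mat (similarity_mat \<beta> l1_dist S)" "D S \<le> M"
    "D S = M \<longleftrightarrow> p ` S = q ` {1..k}" if "admissible S" for S
  proof -
    have S: "S \<subseteq> ?G" "card S = Suc n"
      using that by (auto simp: admissible_def k)
    have sub: "p ` S \<subseteq> {0..L}"
      using image_mono[OF S(1), of p] p_image by simp
    have d: "l1_dist y z = \<bar>p y - p z\<bar>" if "y \<in> S" "z \<in> S" for y z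
      using that S(1) by (intro dist) auto
    note * = solow_polasky_segment[where p = p and d = l1_dist,
        OF \<open>0 < \<beta>\<close> \<open>0 < L\<close> n inj_on_subset[OF inj S(1)] S(2) sub d]
    show "invertible_mat (similarity_mat \<beta> l1_dist S)" "D S \<le> M"
      "D S = M \<longleftrightarrow> p ` S = q ` {1..k}"
      unfolding D_def M_def q_image using * by simp_all
  qed
  have card: "card S = k" if "S \<subseteq> ?G" "p ` S = q ` {1..k}" for S
    using that card_image[OF inj_on_subset[OF inj that(1)]] card_image[OF inj_q] by simp
  \<comment> \<open>The prescribed positions lie in the image of the curve under \<open>p\<close>,
    so some subset of the curve realizes them; injectivity of \<open>p\<close> makes it
    unique.\<close>
  obtain S0 where S0: "S0 \<subseteq> ?G" "p ` S0 = q ` {1..k}"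
    using q_range unfolding p_image[symmetric] subset_image_iff by metis
  have S0_unique: "S \<subseteq> ?G \<and> p ` S = q ` {1..k} \<longleftrightarrow> S = S0" for S
  proof
    assume "S \<subseteq> ?G \<and> p ` S = q ` {1..k}"
    then show "S = S0"
      using S0 inj_on_image_eq_iff[OF inj, of S S0] by simp
  qed (use S0 in simp)
  have adm0: "admissible S0" and D0: "D S0 = M"
    using S0 card[OF S0] seg(3)[of S0] by (auto simp: admissible_def)
  \<comment> \<open>\<open>S0\<close> attains the bound \<open>M\<close>, so no maximizer stays
    below \<open>M\<close>, and the equality case on the segment fixes its positions.\<close>
  have argmax: "is_arg_max D admissible S \<longleftrightarrow> S \<subseteq> ?G \<and> p ` S = q ` {1..k}" for S
  proof
    assume S: "is_arg_max D admissible S"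
    then have "admissible S" "\<not> D S0 > D S"
      using adm0 by (auto simp: is_arg_max_def)
    with seg[of S] D0 show "S \<subseteq> ?G \<and> p ` S = q ` {1..k}"
      by (auto simp: admissible_def)
  next
    assume "S \<subseteq> ?G \<and> p ` S = q ` {1..k}"
    then have "S = S0"
      by (simp only: S0_unique)
    then show "is_arg_max D admissible S"
      using adm0 D0 seg(2) by (force simp: is_arg_max_def)
  qed
  have param: "is_arg_max D admissible S \<longleftrightarrow>
      (\<exists>t. t ` {1..k} \<subseteq> {a..b} \<and> S = (\<lambda>i. \<gamma> (t i)) ` {1..k} \<and> (\<forall>i\<in>{1..k}. \<phi> (t i) = q i))" for S
  proof
    assume S: "is_arg_max D admissible S"
    \<comment> \<open>Any parameters that hit the positions will do: the points they give form a set
      with the positions of \<open>S0\<close>, hence \<open>S0\<close> itself.\<close>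
    have "\<forall>i\<in>{1..k}. \<exists>s. s \<in> {a..b} \<and> \<phi> s = q i"
    proof
      fix i
      assume "i \<in> {1..k}"
      then have "q i \<in> \<phi> ` {a..b}"
        using q_range unfolding \<phi>_image by blast
      then show "\<exists>s. s \<in> {a..b} \<and> \<phi> s = q i"
        by auto
    qed
    then obtain t where t: "\<And>i. i \<in> {1..k} \<Longrightarrow> t i \<in> {a..b} \<and> \<phi> (t i) = q i"
      by metis
    have "p ` (\<lambda>i. \<gamma> (t i)) ` {1..k} = q ` {1..k}"
      unfolding image_image by (intro image_cong) (use t in \<open>simp_all add: p_\<gamma>\<close>)
    moreover have "(\<lambda>i. \<gamma> (t i)) ` {1..k} \<subseteq> ?G"
      using t by auto
    ultimately have "(\<lambda>i. \<gamma> (t i)) ` {1..k} = S0"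
      unfolding S0_unique[symmetric] by blast
    moreover have "S = S0"
      using S unfolding argmax S0_unique .
    ultimately show "\<exists>t. t ` {1..k} \<subseteq> {a..b} \<and> S = (\<lambda>i. \<gamma> (t i)) ` {1..k} \<and>
        (\<forall>i\<in>{1..k}. \<phi> (t i) = q i)"
      using t by (intro exI[of _ t]) auto
  next
    assume "\<exists>t. t ` {1..k} \<subseteq> {a..b} \<and> S = (\<lambda>i. \<gamma> (t i)) ` {1..k} \<and> (\<forall>i\<in>{1..k}. \<phi> (t i) = q i)"
    then obtain t where t: "t ` {1..k} \<subseteq> {a..b}" "S = (\<lambda>i. \<gamma> (t i)) ` {1..k}"
      "\<forall>i\<in>{1..k}. \<phi> (t i) = q i"
      by blast
    have "p ` S = q ` {1..k}"
      unfolding t(2) image_image by (intro image_cong) (use t(3) in \<open>simp_all add: p_\<gamma>\<close>)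
    moreover have "S \<subseteq> ?G"
      using t(1,2) by auto
    ultimately show "is_arg_max D admissible S"
      unfolding argmax by blast
  qed
  have mono: "\<phi> s \<le> \<phi> s'" if "s \<in> {a..b}" "s' \<in> {a..b}" "s \<le> s'" for s s'
    using monotone_onD[OF scalar_coord_mono_on[OF or]] that by (simp add: \<phi>_def)
  have spacing: "(\<forall>i\<in>{1..k}. \<phi> (t i) = q i) \<longleftrightarrow>
      (\<forall>i\<in>{1..<k}. l1_dist (\<gamma> (t (i + 1))) (\<gamma> (t i)) = L / (real k - 1))"
    if t: "t ` {1..k} \<subseteq> {a..b}" "mono_on {1..k} t" for t
  proof -
    have t_mem: "t i \<in> {a..b}" if "1 \<le> i" "i \<le> k" for i
      using that by (intro subsetD[OF t(1)] imageI) simp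
    have gap: "l1_dist (\<gamma> (t (i + 1))) (\<gamma> (t i)) = \<phi> (t (i + 1)) - \<phi> (t i)"
      if "i \<in> {1..<k}" for i
    proof -
      have "t i \<le> t (i + 1)"
        using that by (intro monotone_onD[OF t(2)]) auto
      then show ?thesis
        using l1_dist_on_curve[OF or, of "t (i + 1)" "t i"] mono[of "t i" "t (i + 1)"]
          t_mem[of i] t_mem[of "i + 1"] that by (simp add: \<phi>_def)
    qed
    show ?thesis
    proof
      assume *: "\<forall>i\<in>{1..k}. \<phi> (t i) = q i"
      show "\<forall>i\<in>{1..<k}. l1_dist (\<gamma> (t (i + 1))) (\<gamma> (t i)) = L / (real k - 1)"
      proof
        fix i
        assume i: "i \<in> {1..<k}"
        then have "\<phi> (t i) = q i" "\<phi> (t (i + 1)) = q (i + 1)"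
          by (intro bspec[OF *]; simp)+
        then show "l1_dist (\<gamma> (t (i + 1))) (\<gamma> (t i)) = L / (real k - 1)"
          unfolding gap[OF i] q_step by simp
      qed
    next
      assume *: "\<forall>i\<in>{1..<k}. l1_dist (\<gamma> (t (i + 1))) (\<gamma> (t i)) = L / (real k - 1)"
      \<comment> \<open>Equal spacing fixes the positions up to a translation. As
        \<open>q k = L\<close>, only translation by 0 keeps both ends in
        \<open>{0..L}\<close>.\<close>
      have shift: "\<phi> (t i) = \<phi> (t 1) + q i" if "1 \<le> i" "i \<le> k" for i
        using that
      proof (induction i rule: dec_induct)
        case base
        show ?case by (simp add: q_def)
      next
        case (step i)
        have "\<phi> (t (i + 1)) = \<phi> (t i) + L / (real k - 1)"
          using bspec[OF *, of i] gap[of i] step by simp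
        then show ?case
          using step q_step[of i] by simp
      qed
      have "\<phi> (t 1) \<in> {0..L}" "\<phi> (t k) \<in> {0..L}"
        unfolding \<phi>_image[symmetric] using k by (intro imageI t_mem; simp)+
      moreover have "q k = L"
        using n by (simp add: q_def k)
      ultimately have "\<phi> (t 1) = 0"
        using shift[of k] k by simp
      then show "\<forall>i\<in>{1..k}. \<phi> (t i) = q i"
        using shift by force
    qed
  qed
  \<comment> \<open>The description by positions does not ask for ordered parameters, the one by
    spacing does. The order is automatic, since \<open>\<phi>\<close> is nondecreasing and
    \<open>q\<close> strictly increasing.\<close>
  have q_mono: "mono_on {1..k} t"
    if t: "t ` {1..k} \<subseteq> {a..b}" "\<forall>i\<in>{1..k}. \<phi> (t i) = q i" for t
  proof (rule monotone_onI)
    fix i j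
    assume ij: "i \<in> {1..k}" "j \<in> {1..k}" "i \<le> j"
    show "t i \<le> t j"
    proof (rule ccontr)
      assume "\<not> t i \<le> t j"
      moreover have "t i \<in> {a..b}" "t j \<in> {a..b}"
        using t(1) ij by blast+
      ultimately have "\<phi> (t j) \<le> \<phi> (t i)"
        by (intro mono) simp_all
      then have "q j \<le> q i" "i \<noteq> j"
        using t(2) ij \<open>\<not> t i \<le> t j\<close> by auto
      moreover have "q i < q j" if "i < j"
        using that \<open>0 < L\<close> n by (simp add: q_def k divide_strict_right_mono)
      ultimately show False
        using ij by simp
    qed
  qed
  have param_dist: "is_arg_max D admissible S \<longleftrightarrow>
      (\<exists>t. t ` {1..k} \<subseteq> {a..b} \<and> mono_on {1..k} t \<and> S = (\<lambda>i. \<gamma> (t i)) ` {1..k} \<and>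
         (\<forall>i\<in>{1..<k}. l1_dist (\<gamma> (t (i + 1))) (\<gamma> (t i)) = L / (real k - 1)))" for S
    unfolding param
  proof (intro iffI; elim exE conjE)
    fix t
    assume t: "t ` {1..k} \<subseteq> {a..b}" "S = (\<lambda>i. \<gamma> (t i)) ` {1..k}" "\<forall>i\<in>{1..k}. \<phi> (t i) = q i"
    have mono_t: "mono_on {1..k} t"
      by (rule q_mono[OF t(1,3)])
    show "\<exists>t. t ` {1..k} \<subseteq> {a..b} \<and> mono_on {1..k} t \<and> S = (\<lambda>i. \<gamma> (t i)) ` {1..k} \<and>
         (\<forall>i\<in>{1..<k}. l1_dist (\<gamma> (t (i + 1))) (\<gamma> (t i)) = L / (real k - 1))"
      using t spacing[OF t(1) mono_t] mono_t by blast
  next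
    fix t
    assume t: "t ` {1..k} \<subseteq> {a..b}" "mono_on {1..k} t" "S = (\<lambda>i. \<gamma> (t i)) ` {1..k}"
      "\<forall>i\<in>{1..<k}. l1_dist (\<gamma> (t (i + 1))) (\<gamma> (t i)) = L / (real k - 1)"
    then show "\<exists>t. t ` {1..k} \<subseteq> {a..b} \<and> S = (\<lambda>i. \<gamma> (t i)) ` {1..k} \<and> (\<forall>i\<in>{1..k}. \<phi> (t i) = q i)"
      using spacing[OF t(1,2)] by blast
  qed
  have invertible: "\<forall>S. admissible S \<longrightarrow> invertible_mat (similarity_mat \<beta> l1_dist S)"
    using seg(1) by blast
  have unique: "\<exists>!S. is_arg_max D admissible S"
    unfolding argmax S0_unique by simp
  have max_val: "\<forall>S. is_arg_max D admissible S \<longrightarrow>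
      D S = 1 + (real k - 1) * tanh (\<beta> * L / (2 * (real k - 1)))"
    unfolding argmax S0_unique using D0 by (simp add: M_def k)
  show ?thesis
    unfolding q_def[symmetric]
    by (intro conjI; (fact invertible unique max_val |
        rule allI, (rule param param_dist | rule impI, elim conjE, rule spacing; assumption)))
qed

end
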